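(* Let $(a_1,\dots,a_n)\in\mathbb{R}^n$ and let $X_1,\dots,X_n$ be real random variables with $|X_i|\le c$ almost surely for all $i$, with $\mathbb{E}[X_iX_j]=0$ for all $i\ne j$, and such that in every outcome at most $s$ of the $X_i$ are non-zero. Then \[\mathbb{E}\Big|\sum_i a_iX_i\Big|\;\ge\;\frac{1}{cs}\,\mathbb{E}\Big[\sum_i|a_i|X_i^2\Big].\] Moreover, this bound is tight even for pairwise independent random variables: there are examples (with $X_i$ pairwise independent, mean-zero, $\{-1,+1\}$-valued, $c=1$, $s=n$) in which equality holds. *)

theory Defs
  imports "HOL-Probability.Probability"
begin

end

theory Submission imports Defs begin

text \<open>For the inequality, test \<open>S = \<Sum>i. a i * X i\<close> against \<open>Y = \<Sum>i. sgn (a i) * X i\<close>: sparsity gives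
  \<open>\<bar>Y\<bar> \<le> c * s\<close> almost surely, and orthogonality gives \<open>E[S * Y] = E[\<Sum>i. \<bar>a i\<bar> * (X i)\<^sup>2]\<close>.
  Equality holds with all \<open>a i = 1\<close> when \<open>X\<close> is a uniformly random row, with a uniformly random
  overall sign, of the Sylvester-Hadamard matrix of order \<open>n = 2 ^ k\<close>: one row sums to \<open>n\<close>
  and the others to \<open>0\<close>.\<close>

lemma sum_lessThan_double:
  fixes f :: "nat \<Rightarrow> real"
  shows "(\<Sum>i<m + m. f i) = (\<Sum>i<m. f i) + (\<Sum>i<m. f (m + i))"
proof -
  have "(\<Sum>i<m + m. f i) = (\<Sum>i<m. f i) + (\<Sum>i\<in>{m..<m+m}. f i)"
    by (metis atLeast0LessThan le_add1 sum.atLeastLessThan_concat zero_le)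
  also have "(\<Sum>i\<in>{m..<m+m}. f i) = (\<Sum>i<m. f (m + i))"
    using sum.shift_bounds_nat_ivl[of f 0 m m] by (simp add: atLeast0LessThan add.commute)
  finally show ?thesis .
qed

text \<open>Rows \<open>r < m\<close> serve as equally likely outcomes and columns
  \<open>i < n\<close> as the sign variables; the model is a Hadamard matrix stacked on its
  negative. Entries are signs for all indices, even out of range, so that variables built from
  \<open>h\<close> are signs at every point of the space, not only on the support.\<close>

definition signed_hadamard :: "nat \<Rightarrow> nat \<Rightarrow> (nat \<Rightarrow> nat \<Rightarrow> real) \<Rightarrow> bool" where
  "signed_hadamard n m h \<longleftrightarrow> m > 0 \<and>
     (\<forall>r i. h r i \<in> {-1, 1}) \<and>
     (\<forall>i<n. (\<Sum>r<m. h r i) = 0) \<and>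
     (\<forall>i<n. \<forall>j<n. i \<noteq> j \<longrightarrow> (\<Sum>r<m. h r i * h r j) = 0) \<and>
     (\<forall>r<m. (\<Sum>i<n. h r i) \<in> {0, real n, - real n})"

lemma signed_hadamardD:
  assumes "signed_hadamard n m h"
  shows "m > 0" and "h r i \<in> {-1, 1}"
    and "i < n \<Longrightarrow> (\<Sum>r<m. h r i) = 0"
    and "i < n \<Longrightarrow> j < n \<Longrightarrow> i \<noteq> j \<Longrightarrow> (\<Sum>r<m. h r i * h r j) = 0"
    and "r < m \<Longrightarrow> (\<Sum>i<n. h r i) \<in> {0, real n, - real n}"
  using assms unfolding signed_hadamard_def by blast+

text \<open>Sylvester's doubling, starting from the rows \<open>1\<close> and \<open>-1\<close>.\<close>
lemma ex_signed_hadamard: "\<exists>m h. signed_hadamard (2 ^ k) m h"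
proof (induction k)
  case 0
  have "(\<Sum>r<2::nat. if r = 0 then 1 else -1 :: real) = 0"
    by (simp add: numeral_2_eq_2)
  then show ?case
    by (intro exI[of _ 2] exI[of _ "\<lambda>r i. if r = 0 then 1 else -1"]) (auto simp: signed_hadamard_def)
next
  case (Suc k)
  define n :: nat where "n = 2 ^ k"
  obtain m h where "signed_hadamard n m h"
    using Suc.IH unfolding n_def by blast
  note h = signed_hadamardD[OF this]
  note mean = h(3) and orth = h(4)
  \<comment> \<open>The block matrix with \<open>h\<close>, \<open>h\<close> on top and
    \<open>h\<close>, \<open>-h\<close> below.\<close>
  define g where "g r i = (if m \<le> r \<and> n \<le> i then -1 else 1) *
      h (if m \<le> r then r - m else r) (if n \<le> i then i - n else i)" for r i
  have n2: "2 ^ Suc k = n + n" by (simp add: n_def)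
  have "(\<Sum>r<m+m. g r i) = 0" if "i < n + n" for i
    using that mean[of i] mean[of "i - n"]
    unfolding sum_lessThan_double by (simp add: g_def sum_negf)
  moreover have "(\<Sum>r<m+m. g r i * g r j) = 0" if "i < n + n" "j < n + n" "i \<noteq> j" for i j
  proof -
    \<comment> \<open>Two columns in the same half give twice an old inner product. For columns in
      different halves the upper and lower blocks cancel, even if both copy the same old
      column.\<close>
    have "(\<Sum>r<m. h r (i - n) * h r (j - n)) = 0" if "n \<le> i" "n \<le> j"
      using orth[of "i - n" "j - n"] that \<open>i < n + n\<close> \<open>j < n + n\<close> \<open>i \<noteq> j\<close> by auto
    then show ?thesis
      using that orth[of i j] unfolding sum_lessThan_double
      by (auto simp: g_def sum_negf)
  qed
  \<comment> \<open>Upper rows double an old row sum; in lower rows the two halves cancel.\<close>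
  moreover have "(\<Sum>i<n+n. g r i) \<in> {0, real (n + n), - real (n + n)}" if "r < m + m" for r
  proof (cases "m \<le> r")
    case True
    then show ?thesis by (simp add: sum_lessThan_double g_def sum_negf)
  next
    case False
    then show ?thesis using h(5)[of r] by (auto simp: sum_lessThan_double g_def)
  qed
  moreover have "g r i \<in> {-1, 1}" for r i
    using h(2)[of "if m \<le> r then r - m else r" "if n \<le> i then i - n else i"] by (auto simp: g_def)
  ultimately show ?case
    unfolding n2 signed_hadamard_def using h(1) by (intro exI[of _ "m + m"] exI[of _ g]) simp
qed

text \<open>Every event about a sign variable has an affine indicator, so joint probabilities depend
  only on the moments of \<open>X\<close>, \<open>Y\<close> and \<open>X * Y\<close>. When these
  vanish, only the product of the constant terms remains. This turns orthogonality of columns into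
  pairwise independence.\<close>

lemma (in prob_space) indep_var_sign:
  fixes X Y :: "'a \<Rightarrow> real"
  assumes X[measurable]: "random_variable borel X" and Y[measurable]: "random_variable borel Y"
    and sX: "\<And>\<omega>. \<omega> \<in> space M \<Longrightarrow> X \<omega> \<in> {-1, 1}" and sY: "\<And>\<omega>. \<omega> \<in> space M \<Longrightarrow> Y \<omega> \<in> {-1, 1}"
    and EX: "expectation X = 0" and EY: "expectation Y = 0"
    and EXY: "expectation (\<lambda>\<omega>. X \<omega> * Y \<omega>) = 0"
  shows "indep_var borel X borel Y"
proof -
  \<comment> \<open>On \<open>{-1, 1}\<close> the indicator of \<open>A\<close> is the affine function \<open>x \<mapsto> av A + df A * x\<close>.\<close>
  define av df where "av A = (indicator A 1 + indicator A (-1)) / (2 :: real)"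
    and "df A = (indicator A 1 - indicator A (-1)) / (2 :: real)" for A :: "real set"
  have lin: "indicator A x = av A + df A * x" if "x \<in> {-1, 1}" for x A
    using that by (auto simp: av_def df_def field_simps)
  have [simp]: "integrable M X" "integrable M Y" "integrable M (\<lambda>\<omega>. X \<omega> * Y \<omega>)"
    using sX sY by (force intro!: integrable_const_bound[where B = 1] AE_I2)+
  have single: "prob (Z -` A \<inter> space M) = av A"
    if [measurable]: "random_variable borel Z" "A \<in> sets borel" and Z: "integrable M Z" "expectation Z = 0"
      "\<And>\<omega>. \<omega> \<in> space M \<Longrightarrow> Z \<omega> \<in> {-1, 1}" for Z :: "'a \<Rightarrow> real" and A
  proof -
    have "prob (Z -` A \<inter> space M) = expectation (indicator (Z -` A \<inter> space M))" by simp
    also have "\<dots> = expectation (\<lambda>\<omega>. av A + df A * Z \<omega>)"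
      using Z(3) by (intro Bochner_Integration.integral_cong) (auto simp: lin[symmetric] indicator_def)
    finally show ?thesis using Z by (simp add: prob_space)
  qed
  have joint: "prob ((X -` A \<inter> space M) \<inter> (Y -` B \<inter> space M)) =
      prob (X -` A \<inter> space M) * prob (Y -` B \<inter> space M)"
    if [measurable]: "A \<in> sets borel" "B \<in> sets borel" for A B
  proof -
    have "prob ((X -` A \<inter> space M) \<inter> (Y -` B \<inter> space M)) =
        expectation (indicator ((X -` A \<inter> space M) \<inter> (Y -` B \<inter> space M)))" by simp
    also have "\<dots> = expectation (\<lambda>\<omega>. (av A + df A * X \<omega>) * (av B + df B * Y \<omega>))"
      using sX sY by (intro Bochner_Integration.integral_cong) (auto simp: lin[symmetric] indicator_def)
    also have "\<dots> = expectation (\<lambda>\<omega>. av A * av B + (av B * df A) * X \<omega> + (av A * df B) * Y \<omega>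
        + (df A * df B) * (X \<omega> * Y \<omega>))"
      by (simp add: algebra_simps)
    also have "\<dots> = av A * av B" by (simp add: prob_space EX EY EXY)
    finally show ?thesis using single[OF X] single[OF Y] EX EY sX sY by simp
  qed
  \<comment> \<open>Independence of the generated sigma-algebras follows from that of
    intersection-stable generators.\<close>
  have stable: "Int_stable {Z -` A \<inter> space M |A. A \<in> sets borel}" for Z :: "'a \<Rightarrow> real"
  proof (safe intro!: Int_stableI)
    fix A B :: "real set" assume "A \<in> sets borel" "B \<in> sets borel"
    then show "\<exists>C. (Z -` A \<inter> space M) \<inter> (Z -` B \<inter> space M) = Z -` C \<inter> space M \<and> C \<in> sets borel"
      by (intro exI[of _ "A \<inter> B"]) auto
  qed
  show ?thesis
    unfolding indep_var_eq
  proof (intro conjI indep_set_sigma_sets stable X Y)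
    show "indep_set {X -` A \<inter> space M |A. A \<in> sets borel} {Y -` A \<inter> space M |A. A \<in> sets borel}"
      by (safe intro!: indep_setI joint measurable_sets[OF X] measurable_sets[OF Y])
  qed
qed

lemma (in prob_space) expectation_abs_sum_ge:
  fixes a :: "'i \<Rightarrow> real" and X :: "'i \<Rightarrow> 'a \<Rightarrow> real" and c :: real and s :: nat
  assumes I: "finite I"
    and X[measurable]: "\<And>i. i \<in> I \<Longrightarrow> random_variable borel (X i)"
    and bound: "\<And>i. i \<in> I \<Longrightarrow> AE \<omega> in M. \<bar>X i \<omega>\<bar> \<le> c"
    and orth: "\<And>i j. i \<in> I \<Longrightarrow> j \<in> I \<Longrightarrow> i \<noteq> j \<Longrightarrow> expectation (\<lambda>\<omega>. X i \<omega> * X j \<omega>) = 0"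
    and sparse: "\<And>\<omega>. \<omega> \<in> space M \<Longrightarrow> card {i \<in> I. X i \<omega> \<noteq> 0} \<le> s"
  shows "1 / (c * real s) * expectation (\<lambda>\<omega>. \<Sum>i\<in>I. \<bar>a i\<bar> * (X i \<omega>)\<^sup>2)
    \<le> expectation (\<lambda>\<omega>. \<bar>\<Sum>i\<in>I. a i * X i \<omega>\<bar>)"
proof (cases "I = {} \<or> c * real s = 0")
  \<comment> \<open>Division by zero yields \<open>0\<close>, so the left side vanishes if
    \<open>c * real s = 0\<close>; for empty \<open>I\<close> both sides vanish.\<close>
  case True
  then show ?thesis by (auto simp: zero_le_mult_iff intro!: integral_nonneg)
next
  case False
  then obtain i where i: "i \<in> I" by auto
  \<comment> \<open>A constant statement that holds almost surely in a probability space is true. An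
    index \<open>i\<close> is required to get it, hence the separate case of empty
    \<open>I\<close>.\<close>
  have "AE \<omega> in M. 0 \<le> c" using bound[OF i] by eventually_elim linarith
  then have c: "c \<ge> 0" by simp
  have cs: "c * real s > 0" using c False by (auto simp: zero_less_mult_iff)
  have intX[simp]: "integrable M (X i)" if "i \<in> I" for i
    using bound[OF that] that by (intro integrable_const_bound[where B = c]) auto
  have intXX[simp]: "integrable M (\<lambda>\<omega>. X i \<omega> * X j \<omega>)" if "i \<in> I" "j \<in> I" for i j
  proof (rule integrable_const_bound[where B = "c * c"])
    show "AE \<omega> in M. norm (X i \<omega> * X j \<omega>) \<le> c * c"
      using bound[OF that(1)] bound[OF that(2)]
      by eventually_elim (simp add: abs_mult mult_mono c)
  qed (use that in measurable)
  define S where "S \<omega> = (\<Sum>i\<in>I. a i * X i \<omega>)" for \<omega>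
  define Y where "Y \<omega> = (\<Sum>i\<in>I. sgn (a i) * X i \<omega>)" for \<omega>
  have SY: "S \<omega> * Y \<omega> = (\<Sum>i\<in>I. \<Sum>j\<in>I. a i * sgn (a j) * (X i \<omega> * X j \<omega>))" for \<omega>
    unfolding S_def Y_def sum_product by (simp add: mult_ac)
  have "expectation (\<lambda>\<omega>. S \<omega> * Y \<omega>) =
      (\<Sum>i\<in>I. \<Sum>j\<in>I. a i * sgn (a j) * expectation (\<lambda>\<omega>. X i \<omega> * X j \<omega>))"
    unfolding SY by simp
  \<comment> \<open>Orthogonality removes the off-diagonal terms; on the diagonal
    \<open>a i * sgn (a i) = \<bar>a i\<bar>\<close>.\<close>
  also have "\<dots> = (\<Sum>i\<in>I. \<Sum>j\<in>I. if i = j then \<bar>a i\<bar> * expectation (\<lambda>\<omega>. (X i \<omega>)\<^sup>2) else 0)"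
    by (intro sum.cong refl) (auto simp: orth power2_eq_square abs_sgn)
  also have "\<dots> = (\<Sum>i\<in>I. \<bar>a i\<bar> * expectation (\<lambda>\<omega>. (X i \<omega>)\<^sup>2))"
    using I by simp
  also have "\<dots> = expectation (\<lambda>\<omega>. \<Sum>i\<in>I. \<bar>a i\<bar> * (X i \<omega>)\<^sup>2)"
    by (simp add: power2_eq_square)
  finally have eq: "expectation (\<lambda>\<omega>. S \<omega> * Y \<omega>) = expectation (\<lambda>\<omega>. \<Sum>i\<in>I. \<bar>a i\<bar> * (X i \<omega>)\<^sup>2)" .
  have "AE \<omega> in M. \<forall>i\<in>I. \<bar>X i \<omega>\<bar> \<le> c"
    using bound I by (simp add: AE_finite_all)
  then have le: "AE \<omega> in M. S \<omega> * Y \<omega> \<le> c * real s * \<bar>S \<omega>\<bar>"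
    using AE_space
  proof eventually_elim
    case (elim \<omega>)
    \<comment> \<open>Only the at most \<open>s\<close> indices in \<open>?J\<close> contribute to
      \<open>Y\<close>, each by at most \<open>c\<close> in absolute value.\<close>
    let ?J = "{i \<in> I. X i \<omega> \<noteq> 0}"
    have "\<bar>Y \<omega>\<bar> = \<bar>\<Sum>i\<in>?J. sgn (a i) * X i \<omega>\<bar>"
      unfolding Y_def using I by (intro arg_cong[where f = abs] sum.mono_neutral_right) auto
    also have "\<dots> \<le> (\<Sum>i\<in>?J. c)"
      using elim c by (intro order_trans[OF sum_abs] sum_mono) (auto simp: abs_mult abs_sgn_eq)
    also have "\<dots> \<le> c * real s"
      using sparse[OF elim(2)] c by (simp add: mult.commute mult_left_mono)
    finally have "\<bar>S \<omega>\<bar> * \<bar>Y \<omega>\<bar> \<le> \<bar>S \<omega>\<bar> * (c * real s)" by (rule mult_left_mono) simp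
    then show ?case by (simp add: abs_mult[symmetric] mult_ac)
  qed
  \<comment> \<open>The expansion \<open>SY\<close> also supplies the integrability of the
    product.\<close>
  have "expectation (\<lambda>\<omega>. S \<omega> * Y \<omega>) \<le> expectation (\<lambda>\<omega>. c * real s * \<bar>S \<omega>\<bar>)"
    using le by (intro integral_mono_AE) (simp_all only: SY, simp_all add: S_def)
  also have "\<dots> = c * real s * expectation (\<lambda>\<omega>. \<bar>S \<omega>\<bar>)" by simp
  finally have "expectation (\<lambda>\<omega>. \<Sum>i\<in>I. \<bar>a i\<bar> * (X i \<omega>)\<^sup>2) \<le> c * real s * expectation (\<lambda>\<omega>. \<bar>S \<omega>\<bar>)"
    unfolding eq .
  then show ?thesis using cs unfolding S_def by (simp add: pos_divide_le_eq mult_ac)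
qed

text \<open>The target value \<open>1\<close> is the lower bound for unit coefficients,
  \<open>c = 1\<close> and \<open>s = n = 2^k\<close>: the squares then sum to \<open>n\<close> in
  every outcome.\<close>

lemma sign_variables_equality:
  "\<exists>(M :: (nat \<Rightarrow> real) measure) (X :: nat \<Rightarrow> (nat \<Rightarrow> real) \<Rightarrow> real).
      prob_space M \<and>
      (\<forall>i\<in>{1..2^k}. X i \<in> borel_measurable M) \<and>
      (\<forall>i\<in>{1..2^k}. \<forall>\<omega>\<in>space M. X i \<omega> \<in> {-1, 1}) \<and>
      (\<forall>i\<in>{1..2^k}. prob_space.expectation M (X i) = 0) \<and>
      (\<forall>i\<in>{1..2^k}. \<forall>j\<in>{1..2^k}. i \<noteq> j \<longrightarrow> prob_space.indep_var M borel (X i) borel (X j)) \<and>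
      prob_space.expectation M (\<lambda>\<omega>. \<bar>\<Sum>i=1..2^k. X i \<omega>\<bar>) = 1"
proof -
  define n :: nat where "n = 2 ^ k"
  have n: "n > 0" by (simp add: n_def)
  obtain m h where "signed_hadamard n m h"
    using ex_signed_hadamard[of k] unfolding n_def by blast
  note h = signed_hadamardD[OF this]
  note m = h(1) and sgn = h(2) and mean = h(3) and orth = h(4) and rows = h(5)
  \<comment> \<open>The row index \<open>r\<close> is coded as the constant function \<open>r\<close>.\<close>
  define p :: "(nat \<Rightarrow> real) pmf" where "p = map_pmf (\<lambda>r _. real r) (pmf_of_set {..<m})"
  \<comment> \<open>The floor of \<open>\<omega> 0\<close> decodes the row; \<open>i - 1\<close>
    shifts the indices \<open>1..n\<close> to the columns \<open>0..n-1\<close>.\<close>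
  define X :: "nat \<Rightarrow> (nat \<Rightarrow> real) \<Rightarrow> real" where "X i \<omega> = h (nat \<lfloor>\<omega> 0\<rfloor>) (i - 1)" for i \<omega>
  have ex: "measure_pmf.expectation p f = (\<Sum>r<m. f (\<lambda>_. real r)) / real m" for f :: "(nat \<Rightarrow> real) \<Rightarrow> real"
    using m by (simp add: p_def integral_pmf_of_set lessThan_empty_iff)
  have rowsum: "(\<Sum>i=1..n. X i \<omega>) = (\<Sum>i<n. h (nat \<lfloor>\<omega> 0\<rfloor>) i)" for \<omega>
    unfolding X_def using sum.atLeast1_atMost_eq[of "\<lambda>i. h (nat \<lfloor>\<omega> 0\<rfloor>) (i - 1)" n] by simp
  have EX: "measure_pmf.expectation p (X i) = 0" if "i \<in> {1..n}" for i
    using that mean[of "i - 1"] by (auto simp: ex X_def)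
  have EXX: "measure_pmf.expectation p (\<lambda>\<omega>. X i \<omega> * X j \<omega>) = 0" if "i \<in> {1..n}" "j \<in> {1..n}" "i \<noteq> j" for i j
    using that orth[of "i - 1" "j - 1"] by (auto simp: ex X_def)
  have sq: "h r i * h r i = 1" for r i using sgn[of r i] by auto
  \<comment> \<open>A row sum \<open>S\<close> lies in \<open>{0, n, -n}\<close>, so \<open>\<bar>S\<bar> = S\<^sup>2 / n\<close>, and \<open>S\<^sup>2\<close> has mean \<open>n\<close> by orthogonality.\<close>
  have "real n * \<bar>\<Sum>i<n. h r i\<bar> = (\<Sum>i<n. h r i) * (\<Sum>i<n. h r i)" if "r < m" for r
    using rows[OF that] by auto
  then have "real n * (\<Sum>r<m. \<bar>\<Sum>i<n. h r i\<bar>) = (\<Sum>r<m. (\<Sum>i<n. h r i) * (\<Sum>i<n. h r i))"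
    by (subst sum_distrib_left) simp
  \<comment> \<open>Moving the sum over rows inside exposes the inner products of columns.\<close>
  also have "\<dots> = (\<Sum>i<n. \<Sum>j<n. \<Sum>r<m. h r i * h r j)"
    unfolding sum_product by (subst sum.swap, subst (2) sum.swap) simp
  also have "\<dots> = (\<Sum>i<n. \<Sum>j<n. if i = j then real m else 0)"
    by (intro sum.cong refl) (auto simp: orth sq)
  also have "\<dots> = real n * real m" by simp
  finally have "(\<Sum>r<m. \<bar>\<Sum>i<n. h r i\<bar>) = real m" using n by simp
  then have "measure_pmf.expectation p (\<lambda>\<omega>. \<bar>\<Sum>i=1..n. X i \<omega>\<bar>) = 1"
    using m unfolding ex rowsum by simp
  moreover have "prob_space.indep_var p borel (X i) borel (X j)" if "i \<in> {1..n}" "j \<in> {1..n}" "i \<noteq> j" for i j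
    using that sgn by (intro measure_pmf.indep_var_sign EX EXX) (auto simp: X_def)
  ultimately show ?thesis
    unfolding n_def[symmetric] using sgn EX
    by (intro exI[of _ "measure_pmf p"] exI[of _ X])
       (auto simp: X_def intro: prob_space_measure_pmf)
qed

theorem theorem1p5:
  "(\<forall>(M :: 'a measure) (n :: nat) (a :: nat \<Rightarrow> real) (X :: nat \<Rightarrow> 'a \<Rightarrow> real) (c :: real) (s :: nat).
      prob_space M \<longrightarrow>
      (\<forall>i\<in>{1..n}. X i \<in> borel_measurable M) \<longrightarrow>
      (\<forall>i\<in>{1..n}. AE \<omega> in M. \<bar>X i \<omega>\<bar> \<le> c) \<longrightarrow>
      (\<forall>i\<in>{1..n}. \<forall>j\<in>{1..n}. i \<noteq> j \<longrightarrow> prob_space.expectation M (\<lambda>\<omega>. X i \<omega> * X j \<omega>) = 0) \<longrightarrow>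
      (\<forall>\<omega>\<in>space M. card {i \<in> {1..n}. X i \<omega> \<noteq> 0} \<le> s) \<longrightarrow>
      prob_space.expectation M (\<lambda>\<omega>. \<bar>\<Sum>i=1..n. a i * X i \<omega>\<bar>)
        \<ge> 1 / (c * real s) * prob_space.expectation M (\<lambda>\<omega>. \<Sum>i=1..n. \<bar>a i\<bar> * (X i \<omega>)\<^sup>2))
   \<and>
   (\<forall>N :: nat. \<exists>n\<ge>N. \<exists>(M :: (nat \<Rightarrow> real) measure) (a :: nat \<Rightarrow> real) (X :: nat \<Rightarrow> (nat \<Rightarrow> real) \<Rightarrow> real).
      prob_space M \<and>
      (\<exists>i\<in>{1..n}. a i \<noteq> 0) \<and>
      (\<forall>i\<in>{1..n}. X i \<in> borel_measurable M) \<and>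
      (\<forall>i\<in>{1..n}. \<forall>\<omega>\<in>space M. X i \<omega> \<in> {-1, 1}) \<and>
      (\<forall>i\<in>{1..n}. prob_space.expectation M (X i) = 0) \<and>
      (\<forall>i\<in>{1..n}. \<forall>j\<in>{1..n}. i \<noteq> j \<longrightarrow> prob_space.indep_var M borel (X i) borel (X j)) \<and>
      prob_space.expectation M (\<lambda>\<omega>. \<bar>\<Sum>i=1..n. a i * X i \<omega>\<bar>)
        = 1 / (1 * real n) * prob_space.expectation M (\<lambda>\<omega>. \<Sum>i=1..n. \<bar>a i\<bar> * (X i \<omega>)\<^sup>2))"
proof (intro conjI allI impI, goal_cases)
  case (1 M n a X c s)
  then show ?case by (intro prob_space.expectation_abs_sum_ge) auto
next
  case (2 N)
  obtain M and X :: "nat \<Rightarrow> (nat \<Rightarrow> real) \<Rightarrow> real" where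
    M: "prob_space M" "\<forall>i\<in>{1..2^N}. X i \<in> borel_measurable M"
      "\<forall>i\<in>{1..2^N}. prob_space.expectation M (X i) = 0"
      "\<forall>i\<in>{1..2^N}. \<forall>j\<in>{1..2^N}. i \<noteq> j \<longrightarrow> prob_space.indep_var M borel (X i) borel (X j)"
      and sgn: "\<forall>i\<in>{1..2^N}. \<forall>\<omega>\<in>space M. X i \<omega> \<in> {-1, 1}"
      and S: "prob_space.expectation M (\<lambda>\<omega>. \<bar>\<Sum>i=1..2^N. X i \<omega>\<bar>) = 1"
    using sign_variables_equality[of N] by blast
  interpret prob_space M by fact
  \<comment> \<open>Squares of signs are \<open>1\<close>, so the right side of the claimed equality
    is \<open>1 / 2 ^ N * 2 ^ N = 1\<close>, matching \<open>S\<close>.\<close>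
  have "(X i \<omega>)\<^sup>2 = 1" if "i \<in> {1..2^N}" "\<omega> \<in> space M" for i \<omega>
    using sgn that by fastforce
  then have "expectation (\<lambda>\<omega>. \<Sum>i=1..2^N. (X i \<omega>)\<^sup>2) = expectation (\<lambda>\<omega>. 2 ^ N)"
    by (intro Bochner_Integration.integral_cong) auto
  then have Q: "expectation (\<lambda>\<omega>. \<Sum>i=1..2^N. (X i \<omega>)\<^sup>2) = 2 ^ N"
    by (simp add: prob_space)
  show ?case
  \<comment> \<open>Since \<open>N < 2 ^ N\<close>, the order \<open>2 ^ N\<close> gives an example
    beyond any prescribed size.\<close>
  proof (intro exI[of _ "2 ^ N"] exI[of _ M] exI[of _ "\<lambda>_. 1"] exI[of _ X] conjI M sgn)
    show "N \<le> 2 ^ N" by (simp add: less_imp_le)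
  qed (use S Q in auto)
qed

end
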